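(* Let $A\in\mathbb{R}^{m\times n}$, $b\in\mathbb{R}^m$, $\lambda>0$, and let $\bar x\in\mathbb{R}^n$ be a solution of $\min_{x\in\mathbb{R}^n}\|Ax-b\|+\lambda\|x\|_1$. Suppose that $A\bar x\ne b$ and that, for $J:=\left\{i\in\{1,\dots,n\}:\left|A_i^{\top}\frac{b-A\bar x}{\|A\bar x-b\|}\right|=\lambda\right\}$, one has $\ker A_J=\{0\}$ and $b\notin\operatorname{rge}A_J$. Then, with $I:=\operatorname{supp}(\bar x)$: (i) $\ker A_I=\{0\}$ and $b\notin\operatorname{rge}A_I$; and (ii) there exists $z\in\left\{\frac{b-A\bar x}{\|A\bar x-b\|}\right\}^{\perp}\cap\ker A_I^{\top}$ such that $\left\|A_{I^C}^{\top}\left(\frac{b-A\bar x}{\|A\bar x-b\|}+z\right)\right\|_\infty<\lambda$.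
   Context: $\|\cdot\|$ is the Euclidean norm, $\|x\|_1=\sum_i|x_i|$, $\|x\|_\infty=\max_i|x_i|$ (equal to $0$ for the empty vector). $\operatorname{supp}(x)=\{i: x_i\ne0\}$. For $K\subseteq\{1,\dots,n\}$, $A_K$ is the $m\times|K|$ matrix formed by the columns $A_i$ of $A$ with $i\in K$ (for $K=\emptyset$: $\ker A_\emptyset=\{0\}$, $\operatorname{rge}A_\emptyset=\{0\}$), and $K^C=\{1,\dots,n\}\setminus K$. $\operatorname{rge}$ denotes the range. *)

theory Defs
  imports "HOL-Analysis.Analysis"
begin

definition supp_vec :: "real ^ 'n \<Rightarrow> 'n set" where
  "supp_vec x = {i. x $ i \<noteq> 0}"

definition norm_one :: "real ^ 'n \<Rightarrow> real" where
  "norm_one x = (\<Sum>i\<in>UNIV. \<bar>x $ i\<bar>)"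

text \<open>
  The size of the matrix \<open>A\<^sub>K\<close> formed by the columns of \<open>A\<close> with index in \<open>K\<close> depends on the
  set \<open>K\<close>, so the coordinate space over \<open>K\<close> is represented inside \<open>real ^ 'n\<close> by the vectors
  that vanish outside \<open>K\<close>, and \<open>A\<^sub>K\<close> and its transpose are given by their action on vectors.
\<close>

definition coord_space :: "'n set \<Rightarrow> (real ^ 'n) set" where
  "coord_space K = {y. supp_vec y \<subseteq> K}"

definition cols_mult :: "real ^ 'n ^ 'm \<Rightarrow> 'n set \<Rightarrow> real ^ 'n \<Rightarrow> real ^ 'm" where
  "cols_mult A K y = (\<Sum>i\<in>K. y $ i *\<^sub>R column i A)"

definition ker_cols :: "real ^ 'n ^ 'm \<Rightarrow> 'n set \<Rightarrow> (real ^ 'n) set" where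
  "ker_cols A K = {y \<in> coord_space K. cols_mult A K y = 0}"

definition rge_cols :: "real ^ 'n ^ 'm \<Rightarrow> 'n set \<Rightarrow> (real ^ 'm) set" where
  "rge_cols A K = cols_mult A K ` coord_space K"

text \<open>
  The result lies in \<open>coord_space K\<close>. The padding with zeros does not affect \<open>infnorm\<close>, the
  library's maximum norm on \<open>real ^ 'n\<close>, and gives the value \<open>0\<close> when \<open>K = {}\<close>.
\<close>

definition cols_transpose_mult :: "real ^ 'n ^ 'm \<Rightarrow> 'n set \<Rightarrow> real ^ 'm \<Rightarrow> real ^ 'n" where
  "cols_transpose_mult A K w = (\<chi> i. if i \<in> K then column i A \<bullet> w else 0)"

definition ker_cols_transpose :: "real ^ 'n ^ 'm \<Rightarrow> 'n set \<Rightarrow> (real ^ 'm) set" where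
  "ker_cols_transpose A K = {w. cols_transpose_mult A K w = 0}"

end

theory Submission
  imports Defs
begin

text \<open>
  First-order optimality gives \<open>\<bar>A\<^sub>i \<bullet> r\<bar> \<le> l\<close> for all \<open>i\<close>, with equality on the support of \<open>xbar\<close>;
  hence \<open>I \<subseteq> J\<close>, and (i) is inherited from \<open>J\<close>. Moreover \<open>b - A xbar\<close> is a multiple of \<open>r\<close> and
  \<open>A xbar\<close> lies in the range of \<open>A\<^sub>J\<close>, so \<open>r\<close> is independent of the (independent) columns in \<open>J\<close>.
  There is thus a \<open>w\<close> orthogonal to \<open>r\<close> and to the columns in \<open>I\<close> with \<open>A\<^sub>i \<bullet> w = - A\<^sub>i \<bullet> r\<close> on
  \<open>J - I\<close>. A small positive multiple \<open>z\<close> of \<open>w\<close> makes the constraints in \<open>J - I\<close> strict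
  and keeps those outside \<open>J\<close> strict.
\<close>

lemma norm_one_add_axis:
  "norm_one (x + axis i t) = norm_one x + (\<bar>x $ i + t\<bar> - \<bar>x $ i\<bar>)"
proof -
  have "norm_one (x + axis i t) - norm_one x = (\<Sum>j\<in>UNIV. if j = i then \<bar>x $ i + t\<bar> - \<bar>x $ i\<bar> else 0)"
    unfolding norm_one_def sum_subtractf[symmetric] by (intro sum.cong) (auto simp: axis_def)
  then show ?thesis by simp
qed

lemma matrix_vector_mult_axis:
  fixes A :: "real ^ 'n ^ 'm"
  shows "A *v axis i t = t *\<^sub>R column i A"
proof -
  have "axis i t = t *\<^sub>R axis i (1::real)"
    by (simp add: vec_eq_iff axis_def)
  then show ?thesis
    by (simp add: matrix_vector_mult_scaleR matrix_vector_mult_basis)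
qed

text \<open>Reduces kernels and ranges of column submatrices to the action of \<open>A\<close>
  itself, where the library's linearity rules for \<open>*v\<close> apply.\<close>

lemma matrix_vector_mult_eq_cols_mult:
  fixes A :: "real ^ 'n ^ 'm"
  assumes "y \<in> coord_space K"
  shows "A *v y = cols_mult A K y"
proof -
  have "A *v y = (\<Sum>i\<in>UNIV. y $ i *\<^sub>R column i A)"
    by (simp add: matrix_mult_sum scalar_mult_eq_scaleR)
  also have "\<dots> = (\<Sum>i\<in>K. y $ i *\<^sub>R column i A)"
    using assms by (intro sum.mono_neutral_right) (auto simp: coord_space_def supp_vec_def)
  finally show ?thesis by (simp add: cols_mult_def)
qed

lemma coord_space_mono: "I \<subseteq> J \<Longrightarrow> coord_space I \<subseteq> coord_space J"
  by (auto simp: coord_space_def)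

lemma subspace_coord_space: "subspace (coord_space K :: (real ^ 'n) set)"
proof -
  have "coord_space K = {y :: real ^ 'n. \<forall>i. i \<notin> K \<longrightarrow> y $ i = 0}"
    by (auto simp: coord_space_def supp_vec_def)
  then show ?thesis by (simp add: subspace_def)
qed

lemma axis_in_coord_space: "i \<in> K \<Longrightarrow> axis i t \<in> coord_space K"
  by (auto simp: coord_space_def supp_vec_def axis_def split: if_splits)

lemma ker_cols_eq: "ker_cols A K = {y \<in> coord_space K. A *v y = 0}"
  by (auto simp: ker_cols_def matrix_vector_mult_eq_cols_mult)

lemma rge_cols_eq: "rge_cols A K = (*v) A ` coord_space K"
  unfolding rge_cols_def by (intro image_cong refl) (simp add: matrix_vector_mult_eq_cols_mult)

text \<open>The right-hand side of \<open>min\<close> equals \<open>norm u\<close> at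
  \<open>t = 0\<close> and is differentiable there because \<open>u \<noteq> 0\<close>. A negative
  derivative would push it below \<open>norm u\<close> for small positive \<open>t\<close>.\<close>

lemma norm_directional_derivative_ge:
  fixes u a :: "'a :: real_inner"
  assumes "u \<noteq> 0" "d > 0"
    and min: "\<And>t. \<lbrakk>0 < t; t < d\<rbrakk> \<Longrightarrow> norm u \<le> norm (u + t *\<^sub>R a) + c * t"
  shows "0 \<le> a \<bullet> (u /\<^sub>R norm u) + c"
proof (rule ccontr)
  assume neg: "\<not> ?thesis"
  have "((\<lambda>t. norm (u + t *\<^sub>R a) + c * t) has_real_derivative (a \<bullet> (u /\<^sub>R norm u) + c)) (at 0)"
    unfolding has_field_derivative_def
  proof (rule derivative_eq_intros)
    have "((\<lambda>t. u + t *\<^sub>R a) has_derivative (\<lambda>t. t *\<^sub>R a)) (at 0)"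
      by (auto intro!: derivative_eq_intros)
    then show "((\<lambda>t. norm (u + t *\<^sub>R a)) has_derivative (\<lambda>t. (t *\<^sub>R a) \<bullet> sgn u)) (at 0)"
      by (rule has_derivative_compose) (use has_derivative_norm[OF \<open>u \<noteq> 0\<close>] in simp)
    show "((*) c has_derivative (*) c) (at 0)"
      by (auto intro!: derivative_eq_intros)
    show "(\<lambda>t. (t *\<^sub>R a) \<bullet> sgn u + c * t) = (*) (a \<bullet> (u /\<^sub>R norm u) + c)"
      by (auto simp: sgn_div_norm algebra_simps)
  qed
  from DERIV_neg_dec_right[OF this] neg obtain e where "e > 0"
    and e: "\<And>h. \<lbrakk>0 < h; h < e\<rbrakk> \<Longrightarrow> norm (u + h *\<^sub>R a) + c * h < norm u"
    by auto
  from \<open>e > 0\<close> \<open>d > 0\<close> obtain t where "0 < t" "t < d" "t < e"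
    by (metis field_lbound_gt_zero)
  with e[of t] min[of t] show False by linarith
qed

text \<open>Perturbing a single coordinate suffices: the penalty then changes only through
  \<open>\<bar>x $ i\<bar>\<close>, so one-sided derivatives replace the subdifferential.\<close>

lemma l1_optimality:
  fixes A :: "real ^ 'n ^ 'm"
  assumes opt: "is_arg_min (\<lambda>x. norm (A *v x - b) + l * norm_one x) (\<lambda>x. True) x"
    and ne: "A *v x \<noteq> b" and "l > 0"
    and r: "r = (b - A *v x) /\<^sub>R norm (A *v x - b)"
  shows "\<bar>column i A \<bullet> r\<bar> \<le> l" and "x $ i \<noteq> 0 \<Longrightarrow> \<bar>column i A \<bullet> r\<bar> = l"
proof -
  define u where "u = A *v x - b"
  have u: "u \<noteq> 0" using ne by (simp add: u_def)
  have ur: "v \<bullet> (u /\<^sub>R norm u) = - (v \<bullet> r)" for v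
    by (simp add: u_def r algebra_simps)
  have min: "norm u \<le> norm (u + t *\<^sub>R column i A) + l * (\<bar>x $ i + t\<bar> - \<bar>x $ i\<bar>)" for t
  proof -
    have "norm (A *v x - b) + l * norm_one x
        \<le> norm (A *v (x + axis i t) - b) + l * norm_one (x + axis i t)"
      using opt by (auto simp: is_arg_min_def not_less)
    then show ?thesis
      by (simp add: u_def norm_one_add_axis matrix_vector_mult_axis algebra_simps)
  qed
  \<comment> \<open>Here \<open>s\<close> is the signed speed of coordinate \<open>i\<close>, and
    \<open>c\<close> bounds the growth rate of the penalty up to time \<open>d\<close>.\<close>
  have dir: "s * (column i A \<bullet> r) \<le> c"
    if d: "d > 0" and c: "\<And>t. \<lbrakk>0 < t; t < d\<rbrakk> \<Longrightarrow> l * (\<bar>x $ i + s * t\<bar> - \<bar>x $ i\<bar>) \<le> c * t"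
    for s c d
  proof -
    have "0 \<le> (s *\<^sub>R column i A) \<bullet> (u /\<^sub>R norm u) + c"
    proof (rule norm_directional_derivative_ge[OF u d])
      fix t assume t: "0 < t" "t < d"
      from min[of "s * t"] c[OF t]
      show "norm u \<le> norm (u + t *\<^sub>R s *\<^sub>R column i A) + c * t"
        by (simp add: mult.commute)
    qed
    then show ?thesis unfolding ur by simp
  qed
  have "1 * (column i A \<bullet> r) \<le> l" "- 1 * (column i A \<bullet> r) \<le> l"
    by (rule dir[OF zero_less_one]; use \<open>l > 0\<close> in auto)+
  then show le: "\<bar>column i A \<bullet> r\<bar> \<le> l" by auto
  assume xi: "x $ i \<noteq> 0"
  \<comment> \<open>Moving \<open>x $ i\<close> towards 0 causes no sign change before time
    \<open>\<bar>x $ i\<bar>\<close>, so the penalty falls at rate exactly \<open>l\<close>.\<close>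
  have "- sgn (x $ i) * (column i A \<bullet> r) \<le> - l"
    by (rule dir[of "\<bar>x $ i\<bar>"]) (use xi in \<open>auto simp: sgn_if abs_if algebra_simps\<close>)
  then show "\<bar>column i A \<bullet> r\<bar> = l"
    using le by (auto simp: sgn_if split: if_splits)
qed

text \<open>The hypotheses make \<open>r\<close> and the columns in \<open>J\<close> linearly
  independent, so a linear functional can take prescribed values on them; \<open>w\<close> is its
  Riesz representative.\<close>

lemma exists_vector_with_inner_products:
  fixes A :: "real ^ 'n ^ 'm" and r :: "real ^ 'm" and c :: "'n \<Rightarrow> real"
  assumes ker: "ker_cols A J = {0}" and r: "r \<notin> rge_cols A J"
  obtains w where "r \<bullet> w = 0" "\<And>i. i \<in> J \<Longrightarrow> column i A \<bullet> w = c i"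
proof -
  define f where "f = (\<lambda>p :: (real ^ 'n) \<times> real. A *v fst p + snd p *\<^sub>R r)"
  let ?S = "coord_space J \<times> (UNIV :: real set)"
  have S: "subspace ?S"
    by (intro subspace_Times subspace_coord_space subspace_UNIV)
  have f: "linear f"
    unfolding f_def by (rule linearI) (auto simp: algebra_simps)
  \<comment> \<open>This is the linear independence: \<open>f\<close> forms combinations of the
    columns in \<open>J\<close> and \<open>r\<close>.\<close>
  have inj: "inj_on f ?S"
  proof (subst linear_inj_on_iff_eq_0[OF f S], clarify)
    fix y t assume y: "y \<in> coord_space J" and 0: "f (y, t) = 0"
    have t: "t = 0"
    proof (rule ccontr)
      assume "t \<noteq> 0"
      have "A *v y = - (t *\<^sub>R r)"
        using 0 by (simp add: f_def eq_neg_iff_add_eq_0)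
      then have "r = A *v ((- inverse t) *\<^sub>R y)"
        using \<open>t \<noteq> 0\<close> by (simp only: matrix_vector_mult_scaleR) simp
      moreover have "(- inverse t) *\<^sub>R y \<in> coord_space J"
        using y by (intro subspace_scale subspace_coord_space)
      ultimately show False using r by (auto simp: rge_cols_eq)
    qed
    with 0 y ker show "(y, t) = 0"
      by (auto simp: ker_cols_eq f_def zero_prod_def)
  qed
  from linear_exists_left_inverse_on[OF f S inj]
  obtain g where g: "linear g" and gf: "\<And>p. p \<in> ?S \<Longrightarrow> g (f p) = p" by auto
  \<comment> \<open>\<open>g\<close> recovers the coefficients of a combination; \<open>h\<close>
    weights those of the columns by \<open>c\<close> and ignores that of \<open>r\<close>.\<close>
  define h where "h v = (\<Sum>i\<in>UNIV. c i * fst (g v) $ i)" for v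
  have h: "linear h"
    by (rule linearI) (simp_all add: h_def linear_add[OF g] linear_scale[OF g] sum.distrib
        sum_distrib_left algebra_simps)
  have hw: "v \<bullet> adjoint h 1 = h v" for v
    using adjoint_works[OF h, of v 1] by simp
  show thesis
  proof
    have "g (f (0, 1)) = (0, 1)"
      by (intro gf) (auto intro: subspace_0 subspace_coord_space)
    then show "r \<bullet> adjoint h 1 = 0" by (simp add: hw h_def f_def)
    fix i assume "i \<in> J"
    then have "g (f (axis i 1, 0)) = (axis i 1, 0)"
      by (intro gf) (auto intro: axis_in_coord_space)
    then have "g (column i A) = (axis i 1, 0)"
      by (simp add: f_def matrix_vector_mult_axis)
    then show "column i A \<bullet> adjoint h 1 = c i"
      by (simp add: hw h_def axis_def if_distrib cong: if_cong)
  qed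
qed

lemma infnorm_less_cart:
  fixes x :: "real ^ 'n"
  assumes "\<And>i. \<bar>x $ i\<bar> < l"
  shows "infnorm x < l"
proof -
  have "infnorm x = Max ((\<lambda>i. \<bar>x \<bullet> i\<bar>) ` Basis)" by (rule infnorm_Max)
  also have "\<dots> < l"
    using assms by (auto simp: Basis_vec_def inner_axis)
  finally show ?thesis .
qed

theorem proposition3p7:
  fixes A :: "real ^ 'n ^ 'm" and b r :: "real ^ 'm" and l :: real
    and xbar :: "real ^ 'n" and I J :: "'n set"
  assumes "l > 0"
    and "is_arg_min (\<lambda>x. norm (A *v x - b) + l * norm_one x) (\<lambda>x. True) xbar"
    and "A *v xbar \<noteq> b"
    and "r = (b - A *v xbar) /\<^sub>R norm (A *v xbar - b)"
    and "J = {i. \<bar>column i A \<bullet> r\<bar> = l}"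
    and "ker_cols A J = {0}"
    and "b \<notin> rge_cols A J"
    and "I = supp_vec xbar"
  shows "(ker_cols A I = {0} \<and> b \<notin> rge_cols A I) \<and>
    (\<exists>z \<in> orthogonal_comp {r} \<inter> ker_cols_transpose A I.
       infnorm (cols_transpose_mult A (- I) (r + z)) < l)"
proof (intro conjI)
  note opt = l1_optimality[OF assms(2,3,1,4)]
  have IJ: "I \<subseteq> J"
    using opt(2) by (auto simp: assms(5,8) supp_vec_def)
  then have sub: "coord_space I \<subseteq> (coord_space J :: (real ^ 'n) set)"
    by (rule coord_space_mono)
  have "0 \<in> (coord_space I :: (real ^ 'n) set)"
    by (rule subspace_0[OF subspace_coord_space])
  then show "ker_cols A I = {0}"
    using assms(6) sub by (auto simp: ker_cols_eq)
  show "b \<notin> rge_cols A I"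
    using assms(7) sub by (auto simp: rge_cols_eq)
  have "r \<notin> rge_cols A J"
  proof
    assume "r \<in> rge_cols A J"
    then obtain y where y: "y \<in> coord_space J" "r = A *v y"
      by (auto simp: rge_cols_eq)
    have "xbar \<in> coord_space J"
      using IJ by (simp add: coord_space_def assms(8))
    \<comment> \<open>The definition of \<open>r\<close> is solved for \<open>b\<close>, with
      \<open>A *v y\<close> in place of \<open>r\<close>.\<close>
    moreover have "b = A *v (xbar + norm (A *v xbar - b) *\<^sub>R y)"
      using assms(3) by (simp add: matrix_vector_right_distrib matrix_vector_mult_scaleR
          flip: y(2)) (simp add: assms(4))
    ultimately have "b \<in> rge_cols A J"
      using y(1) by (auto simp: rge_cols_eq intro!: subspace_add subspace_scale
          subspace_coord_space)
    with assms(7) show False ..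
  qed
  from exists_vector_with_inner_products[OF assms(6) this,
      of "\<lambda>i. if i \<in> I then 0 else - (column i A \<bullet> r)"]
  obtain w where rw: "r \<bullet> w = 0"
    and w: "\<And>i. i \<in> J \<Longrightarrow> column i A \<bullet> w = (if i \<in> I then 0 else - (column i A \<bullet> r))"
    by blast
  have "\<forall>\<^sub>F e in at_right 0. \<bar>column i A \<bullet> (r + e *\<^sub>R w)\<bar> < l" if "i \<in> - I" for i
  proof (cases "i \<in> J")
    case True
    have "\<forall>\<^sub>F e in at_right 0. 0 < e \<and> e < (1::real)"
      using eventually_at_right_real[of 0 "1::real"] by simp
    then show ?thesis
    proof eventually_elim
      case (elim e)
      \<comment> \<open>On \<open>J - I\<close> the prescribed value of \<open>w\<close> shrinks the
        product, whose modulus was \<open>l\<close>, by the factor \<open>1 - e\<close>.\<close>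
      have "column i A \<bullet> (r + e *\<^sub>R w) = (1 - e) * (column i A \<bullet> r)"
        using w[OF True] that by (simp add: algebra_simps)
      then have "\<bar>column i A \<bullet> (r + e *\<^sub>R w)\<bar> = (1 - e) * l"
        using True elim by (simp add: abs_mult assms(5))
      then show ?case using elim assms(1) by simp
    qed
  next
    case False
    \<comment> \<open>Outside \<open>J\<close> the bound is already strict at \<open>e = 0\<close>
      and persists by continuity.\<close>
    have "((\<lambda>e. \<bar>column i A \<bullet> (r + e *\<^sub>R w)\<bar>) \<longlongrightarrow> \<bar>column i A \<bullet> (r + 0 *\<^sub>R w)\<bar>) (at_right 0)"
      by (intro tendsto_intros)
    moreover have "\<bar>column i A \<bullet> (r + 0 *\<^sub>R w)\<bar> < l"
      using False opt(1)[of i] by (auto simp: assms(5))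
    ultimately show ?thesis by (rule order_tendstoD)
  qed
  then have "\<forall>\<^sub>F e in at_right 0. \<forall>i\<in>- I. \<bar>column i A \<bullet> (r + e *\<^sub>R w)\<bar> < l"
    by (intro eventually_ball_finite) auto
  then have "\<exists>e. \<forall>i\<in>- I. \<bar>column i A \<bullet> (r + e *\<^sub>R w)\<bar> < l"
    by (rule eventually_happens'[rotated]) simp
  then obtain e where e: "\<And>i. i \<in> - I \<Longrightarrow> \<bar>column i A \<bullet> (r + e *\<^sub>R w)\<bar> < l"
    by blast
  have "e *\<^sub>R w \<in> orthogonal_comp {r}"
    by (simp add: orthogonal_comp_def orthogonal_def rw)
  moreover have "e *\<^sub>R w \<in> ker_cols_transpose A I"
    using IJ w by (auto simp: ker_cols_transpose_def cols_transpose_mult_def vec_eq_iff)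
  \<comment> \<open>The padded entries at indices in \<open>I\<close> are 0, hence below
    \<open>l\<close> since \<open>l > 0\<close>.\<close>
  moreover have "infnorm (cols_transpose_mult A (- I) (r + e *\<^sub>R w)) < l"
    by (rule infnorm_less_cart) (use e assms(1) in \<open>auto simp: cols_transpose_mult_def\<close>)
  ultimately show "\<exists>z \<in> orthogonal_comp {r} \<inter> ker_cols_transpose A I.
       infnorm (cols_transpose_mult A (- I) (r + z)) < l"
    by blast
qed

end
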